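(* Let $R>0$, let $N\ge 2$ be an integer, $w=R/N$, let $\varepsilon_1<\dots<\varepsilon_N$ be equally spaced points in $[0,R]$, and let values $\rho(\varepsilon_i)\ge0$ and $f_i\ge 0$, $i=1,\dots,N$, be given. Then all the $N$ quantities $$\tilde Q_R(f)(\varepsilon_i)=w^2\sum_{\substack{j,l=1\\ 1\le k=i+j-l\le N}}^N\rho(\min\{\varepsilon_i,\varepsilon_j,\varepsilon_k,\varepsilon_l\})\,[f_kf_l(1+f_i)(1+f_j)-f_if_j(1+f_k)(1+f_l)],\qquad i=1,\dots,N,$$ can be computed with a total of $O(N^2\log_2 N)$ arithmetic operations.
   Context: The sum is over all $j,l\in\{1,\dots,N\}$ for which $k:=i+j-l$ lies in $\{1,\dots,N\}$. Cost is the number of arithmetic operations on (real or complex) numbers, where the roots of unity needed for fast Fourier transforms are available; the constant in $O(\cdot)$ is absolute. The quantities $\tilde Q_R(f)(\varepsilon_i)$ are the quadrature values of a boson collision operator with density of states $\rho$. *)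

theory Defs
  imports Complex_Main
begin

section \<open>The quadrature values of the collision operator\<close>

definition equally_spaced :: "real \<Rightarrow> nat \<Rightarrow> (nat \<Rightarrow> real) \<Rightarrow> bool" where
  "equally_spaced R N eps \<longleftrightarrow>
     (\<forall>i\<in>{1..N}. eps i \<in> {0..R}) \<and>
     strict_mono_on {1..N} eps \<and>
     (\<exists>h. \<forall>i\<in>{1..<N}. eps (Suc i) - eps i = h)"

text \<open>Subtraction on \<open>nat\<close> is harmless in \<open>k = i + j - l\<close>: if \<open>i + j \<le> l\<close>, the truncated
  difference is \<open>0\<close> and the pair \<open>(j, l)\<close> is excluded by \<open>1 \<le> i + j - l\<close>.\<close>

definition Q_tilde ::
  "real \<Rightarrow> nat \<Rightarrow> (nat \<Rightarrow> real) \<Rightarrow> (real \<Rightarrow> real) \<Rightarrow> (nat \<Rightarrow> real) \<Rightarrow> nat \<Rightarrow> real" where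
  "Q_tilde R N eps \<rho> f i =
     (R / real N)\<^sup>2 *
     (\<Sum>(j, l) | j \<in> {1..N} \<and> l \<in> {1..N} \<and> 1 \<le> i + j - l \<and> i + j - l \<le> N.
        let k = i + j - l in
          \<rho> (Min {eps i, eps j, eps k, eps l}) *
          (f k * f l * (1 + f i) * (1 + f j) - f i * f j * (1 + f k) * (1 + f l)))"

section \<open>Arithmetic straight-line programs\<close>

text \<open>A program works on a list of complex numbers, initially the input, to which each instruction
  appends its result. Roots of unity are free operands; every other number that is not an input
  has to be computed. Evaluation is partial: a division by zero makes the program fail, so that
  the convention \<open>x / 0 = 0\<close> cannot be used as a test for zero.\<close>

datatype operand =
    Cell nat
  | Root_Of_Unity nat nat

datatype instr =
    Add operand operand
  | Sub operand operand
  | Mul operand operand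
  | Div operand operand

fun operand_val :: "complex list \<Rightarrow> operand \<Rightarrow> complex option" where
  "operand_val s (Cell n) = (if n < length s then Some (s ! n) else None)"
| "operand_val s (Root_Of_Unity m k) =
     (if m > 0 then Some (cis (2 * pi * real k / real m)) else None)"

definition apply_op ::
  "(complex \<Rightarrow> complex \<Rightarrow> complex) \<Rightarrow> complex option \<Rightarrow> complex option \<Rightarrow> complex option" where
  "apply_op g u v = Option.bind u (\<lambda>x. Option.bind v (\<lambda>y. Some (g x y)))"

fun instr_val :: "complex list \<Rightarrow> instr \<Rightarrow> complex option" where
  "instr_val s (Add a b) = apply_op (+) (operand_val s a) (operand_val s b)"
| "instr_val s (Sub a b) = apply_op (-) (operand_val s a) (operand_val s b)"
| "instr_val s (Mul a b) = apply_op (*) (operand_val s a) (operand_val s b)"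
| "instr_val s (Div a b) =
     (if operand_val s b = Some 0 then None
      else apply_op (/) (operand_val s a) (operand_val s b))"

fun exec :: "instr list \<Rightarrow> complex list \<Rightarrow> complex list option" where
  "exec [] s = Some s"
| "exec (c # cs) s = Option.bind (instr_val s c) (\<lambda>v. exec cs (s @ [v]))"

datatype program = Program (code: "instr list") (outputs: "operand list")

definition cost :: "program \<Rightarrow> nat" where
  "cost P = length (code P)"

definition computes :: "program \<Rightarrow> complex list \<Rightarrow> complex list \<Rightarrow> bool" where
  "computes P xs ys \<longleftrightarrow>
     (\<exists>s. exec (code P) xs = Some s \<and> map (operand_val s) (outputs P) = map Some ys)"

end

theory Submission
  imports Defs
begin

text \<open>
  Write \<open>r m\<close> for the value of the density of states at the \<open>m\<close>-th grid point. The grid is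
  strictly increasing, so the density at the smallest of four grid points is \<open>r\<close> at the smallest
  of the four indices (\<open>Q_tilde_eq\<close>). The quartic terms of the bracket cancel, which leaves
  \<open>f k * f l * (1 + f i + f j) - f i * f j * (1 + f k + f l)\<close>. In the terms with fixed
  \<open>i\<close> and \<open>j\<close>, the factors that depend on \<open>(i, j)\<close> come out of the sum over
  \<open>k + l = i + j\<close>. What remains are the two inner sums of
  \<open>r (min p (min k l)) * u k l\<close> over \<open>k + l = s\<close>, with \<open>u k l = f k * f l\<close> or
  \<open>u k l = 1 + f k + f l\<close>, and these depend on \<open>(i, j)\<close> only through
  \<open>s = i + j\<close> and \<open>p = min i j\<close> (\<open>collision_eq\<close>).

  There are only \<open>2 N\<^sup>2\<close> pairs \<open>(s, p)\<close>, and each inner sum costs a bounded number of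
  operations once its neighbours are known. The layer-cake formula writes \<open>r (min p m)\<close> as the sum
  of the increments of \<open>r\<close> up to \<open>min p m\<close>. Hence the inner sums for a fixed \<open>s\<close> are prefix sums in
  \<open>p\<close> of increments times suffix sums, where the suffix sums collect the pairs \<open>(k, l)\<close>
  with \<open>min k l \<ge> q\<close> (\<open>inner_eq\<close>). On the line \<open>k + l = s\<close> at most two pairs have
  a given minimum, so a row of \<open>N\<close> inner sums costs at most \<open>5 * N\<close> operations
  (\<open>adjoins_inner_row\<close>). In total \<open>33 * N\<^sup>2\<close> operations suffice
  (\<open>adjoins_collision\<close>). Running sums take the place of fast Fourier transforms, and the
  claim follows because \<open>log 2 N \<ge> 1\<close> for \<open>N \<ge> 2\<close>.

  To keep cell addresses out of the counting, intermediate results are treated as functions of the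
  input, and \<open>adjoins A n B\<close> says that \<open>n\<close> operations lead from the set \<open>A\<close> of known
  functions to all those in \<open>B\<close>. Such bounds compose, and \<open>adjoins_program\<close> turns them
  into one straight-line program that is correct for every input.
\<close>

section \<open>Counting operations without addresses\<close>

text \<open>A denominator has to be nonzero on all inputs, because one program serves them all and
  fails on a division by zero.\<close>

definition one_op :: "('e \<Rightarrow> complex) set \<Rightarrow> ('e \<Rightarrow> complex) \<Rightarrow> bool" where
  "one_op A v \<longleftrightarrow> (\<exists>a\<in>A. \<exists>b\<in>A.
     v = (\<lambda>e. a e + b e) \<or> v = (\<lambda>e. a e - b e) \<or> v = (\<lambda>e. a e * b e) \<or>
     ((\<forall>e. b e \<noteq> 0) \<and> v = (\<lambda>e. a e / b e)))"

text \<open>The constant \<open>1\<close> is a root of unity, hence a free operand; it enters by a rule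
  that leaves the count unchanged. All other constants are built from it and counted. The number
  \<open>n\<close> is an upper bound, which makes the relation monotone.\<close>

inductive adjoins :: "('e \<Rightarrow> complex) set \<Rightarrow> nat \<Rightarrow> ('e \<Rightarrow> complex) set \<Rightarrow> bool" where
  already: "B \<subseteq> A \<Longrightarrow> adjoins A n B"
| one: "adjoins (insert (\<lambda>_. 1) A) n B \<Longrightarrow> adjoins A n B"
| step: "one_op A v \<Longrightarrow> adjoins (insert v A) n B \<Longrightarrow> adjoins A (Suc n) B"

lemma one_op_mono: "one_op A v \<Longrightarrow> A \<subseteq> A' \<Longrightarrow> one_op A' v"
  unfolding one_op_def by blast

lemma one_op_add: "a \<in> A \<Longrightarrow> b \<in> A \<Longrightarrow> one_op A (\<lambda>e. a e + b e)"
  and one_op_diff: "a \<in> A \<Longrightarrow> b \<in> A \<Longrightarrow> one_op A (\<lambda>e. a e - b e)"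
  and one_op_mult: "a \<in> A \<Longrightarrow> b \<in> A \<Longrightarrow> one_op A (\<lambda>e. a e * b e)"
  and one_op_divide: "a \<in> A \<Longrightarrow> b \<in> A \<Longrightarrow> (\<And>e. b e \<noteq> 0) \<Longrightarrow> one_op A (\<lambda>e. a e / b e)"
  unfolding one_op_def by blast+

lemma adjoins_mono:
  "adjoins A n B \<Longrightarrow> A \<subseteq> A' \<Longrightarrow> n \<le> n' \<Longrightarrow> B' \<subseteq> B \<Longrightarrow> adjoins A' n' B'"
proof (induction arbitrary: A' n' rule: adjoins.induct)
  case (already B A n)
  then show ?case by (blast intro: adjoins.already)
next
  case (one A n B)
  show ?case by (rule adjoins.one, rule one.IH) (use one.prems in auto)
next
  case (step A v n B)
  obtain k where k: "n' = Suc k" "n \<le> k"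
    using step.prems(2) by (cases n') auto
  have "adjoins (insert v A') k B'"
    by (rule step.IH) (use step.prems k in auto)
  with step.hyps(1) step.prems(1) k(1) show ?case
    by (auto intro: adjoins.step one_op_mono)
qed

lemma adjoins_trans: "adjoins A n B \<Longrightarrow> adjoins (A \<union> B) m C \<Longrightarrow> adjoins A (n + m) C"
proof (induction rule: adjoins.induct)
  case (already B A n)
  then have "adjoins A m C" by (simp add: Un_absorb2)
  then show ?case by (rule adjoins_mono) auto
next
  case (one A n B)
  have "adjoins (insert (\<lambda>_. 1) A) (n + m) C"
    by (rule one.IH, rule adjoins_mono[OF one.prems]) auto
  then show ?case by (rule adjoins.one)
next
  case (step A v n B)
  have "adjoins (insert v A) (n + m) C"
    by (rule step.IH, rule adjoins_mono[OF step.prems]) auto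
  with step.hyps(1) show ?case by (simp add: adjoins.step)
qed

text \<open>Results computed on the way to \<open>B\<close> stay available, so \<open>B\<close> can be kept while
  \<open>C\<close> is computed; the induction below has to carry along the initial set as well.\<close>

lemma adjoins_Un:
  assumes "adjoins A n B" and "adjoins A m C"
  shows "adjoins A (n + m) (B \<union> C)"
proof -
  have keep: "adjoins A' k (A' \<union> D)" if "adjoins A' k D" for A' k and D :: "('e \<Rightarrow> complex) set"
    using that
  proof (induction rule: adjoins.induct)
    case (already B A n)
    then show ?case by (auto intro: adjoins.already)
  next
    case (one A n B)
    have "adjoins (insert (\<lambda>_. 1) A) n (A \<union> B)"
      by (rule adjoins_mono[OF one.IH]) auto
    then show ?case by (rule adjoins.one)
  next
    case (step A v n B)
    have "adjoins (insert v A) n (A \<union> B)"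
      by (rule adjoins_mono[OF step.IH]) auto
    with step.hyps(1) show ?case by (rule adjoins.step)
  qed
  have "adjoins (A \<union> B) m C"
    by (rule adjoins_mono[OF assms(2)]) auto
  then have "adjoins (A \<union> B) m (B \<union> C)"
    by (rule adjoins_mono[OF keep]) auto
  with assms(1) show ?thesis by (rule adjoins_trans)
qed

lemma adjoins_one_op: "one_op A v \<Longrightarrow> adjoins A 1 {v}"
  unfolding One_nat_def by (erule adjoins.step) (simp add: adjoins.already)

lemma adjoins_UN:
  assumes "finite I" and "\<And>i. i \<in> I \<Longrightarrow> adjoins A n (B i)"
  shows "adjoins A (card I * n) (\<Union>i\<in>I. B i)"
  using assms
proof (induction I rule: finite_induct)
  case empty
  then show ?case by (simp add: adjoins.already)
next
  case (insert i I)
  have "adjoins A (n + card I * n) (B i \<union> (\<Union>j\<in>I. B j))"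
    using insert by (intro adjoins_Un) auto
  then show ?case using insert.hyps by simp
qed

lemma adjoins_image:
  assumes "finite I" and "\<And>i. i \<in> I \<Longrightarrow> adjoins A n {F i}"
  shows "adjoins A (card I * n) (F ` I)"
  using adjoins_UN[of I A n "\<lambda>i. {F i}"] assms by (simp add: UNION_singleton_eq_range)

text \<open>All partial sums together cost no more than the last one. This is where the factor
  \<open>N\<close> over the direct evaluation of the collision sum is gained.\<close>

lemma adjoins_running:
  assumes "S 0 \<in> A" and "\<And>p. p < n \<Longrightarrow> \<exists>a\<in>A. S (Suc p) = (\<lambda>e. S p e + a e)"
  shows "adjoins A n (S ` {..n})"
  using assms
proof (induction n)
  case 0
  then show ?case by (simp add: adjoins.already)
next
  case (Suc n)
  obtain a where "a \<in> A" "S (Suc n) = (\<lambda>e. S n e + a e)"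
    using Suc.prems(2) by blast
  then have last: "adjoins (A \<union> S ` {..n}) 1 {S (Suc n)}"
    by (auto simp del: One_nat_def intro!: adjoins_one_op one_op_add)
  have earlier: "adjoins (A \<union> S ` {..n}) 0 (S ` {..n})"
    by (rule adjoins.already) simp
  have "adjoins A n (S ` {..n})" using Suc by simp
  from adjoins_trans[OF this adjoins_Un[OF earlier last]]
  have "adjoins A (n + (0 + 1)) (S ` {..n} \<union> {S (Suc n)})" .
  moreover have "S ` {..n} \<union> {S (Suc n)} = S ` {..Suc n}"
    by (auto simp: atMost_Suc)
  ultimately show ?case by simp
qed

lemma adjoins_sum:
  assumes "finite I" and "\<And>i. i \<in> I \<Longrightarrow> F i \<in> A" and "(\<lambda>_. 0) \<in> A"
  shows "adjoins A (card I) {\<lambda>e. \<Sum>i\<in>I. F i e}"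
  using assms
proof (induction I rule: finite_induct)
  case empty
  then show ?case by (simp add: adjoins.already)
next
  case (insert i I)
  have "adjoins (A \<union> {\<lambda>e. \<Sum>j\<in>I. F j e}) 1 {\<lambda>e. F i e + (\<Sum>j\<in>I. F j e)}"
    using insert.prems by (intro adjoins_one_op one_op_add) auto
  with insert have "adjoins A (card I + 1) {\<lambda>e. F i e + (\<Sum>j\<in>I. F j e)}"
    by (intro adjoins_trans) auto
  then show ?case using insert.hyps by simp
qed

section \<open>Assigning addresses\<close>

lemma operand_for:
  assumes "v \<in> insert (\<lambda>_. 1) (set vs)"
  shows "\<exists>a. \<forall>e ws. operand_val (map (\<lambda>v. v e) vs @ ws) a = Some (v e)"
proof (cases "v = (\<lambda>_. 1)")
  case True
  then show ?thesis by (intro exI[of _ "Root_Of_Unity 1 0"]) simp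
next
  case False
  then obtain n where "n < length vs" "vs ! n = v"
    using assms by (auto simp: in_set_conv_nth)
  then show ?thesis by (intro exI[of _ "Cell n"]) (simp add: nth_append)
qed

lemma instr_for:
  assumes "one_op A v" and "A \<subseteq> insert (\<lambda>_. 1) (set vs)"
  shows "\<exists>c. \<forall>e. instr_val (map (\<lambda>v. v e) vs) c = Some (v e)"
proof -
  from assms(1) obtain a b where ab: "a \<in> A" "b \<in> A" and
    v: "v = (\<lambda>e. a e + b e) \<or> v = (\<lambda>e. a e - b e) \<or> v = (\<lambda>e. a e * b e) \<or>
     ((\<forall>e. b e \<noteq> 0) \<and> v = (\<lambda>e. a e / b e))"
    unfolding one_op_def by blast
  obtain x where x: "\<And>e. operand_val (map (\<lambda>v. v e) vs) x = Some (a e)"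
    using operand_for[of a vs] ab(1) assms(2) by (metis append_Nil2 subsetD)
  obtain y where y: "\<And>e. operand_val (map (\<lambda>v. v e) vs) y = Some (b e)"
    using operand_for[of b vs] ab(2) assms(2) by (metis append_Nil2 subsetD)
  from v show ?thesis
  proof (elim disjE conjE)
    assume "v = (\<lambda>e. a e + b e)"
    then show ?thesis by (intro exI[of _ "Add x y"]) (simp add: x y apply_op_def)
  next
    assume "v = (\<lambda>e. a e - b e)"
    then show ?thesis by (intro exI[of _ "Sub x y"]) (simp add: x y apply_op_def)
  next
    assume "v = (\<lambda>e. a e * b e)"
    then show ?thesis by (intro exI[of _ "Mul x y"]) (simp add: x y apply_op_def)
  next
    assume "\<forall>e. b e \<noteq> 0" "v = (\<lambda>e. a e / b e)"
    then show ?thesis by (intro exI[of _ "Div x y"]) (simp add: x y apply_op_def)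
  qed
qed

text \<open>Instructions only append, so the list of functions held in the cells grows at its end and
  the addresses chosen earlier stay valid. The code is chosen before the input \<open>e\<close>, as it
  depends on the functions alone.\<close>

lemma adjoins_code:
  assumes "adjoins A n B" and "A \<subseteq> insert (\<lambda>_. 1) (set vs)"
  shows "\<exists>cs ws. length cs \<le> n \<and> B \<subseteq> insert (\<lambda>_. 1) (set ws) \<and>
           (\<forall>e. exec cs (map (\<lambda>v. v e) vs) = Some (map (\<lambda>v. v e) ws))"
  using assms
proof (induction arbitrary: vs rule: adjoins.induct)
  case (already B A n)
  then show ?case by (intro exI[of _ "[]"] exI[of _ vs]) auto
next
  case (one A n B)
  then show ?case by simp
next
  case (step A v n B)
  obtain c where c: "\<And>e. instr_val (map (\<lambda>v. v e) vs) c = Some (v e)"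
    using instr_for[OF step.hyps(1) step.prems] by blast
  obtain cs ws where "length cs \<le> n" "B \<subseteq> insert (\<lambda>_. 1) (set ws)"
    "\<And>e. exec cs (map (\<lambda>v. v e) (vs @ [v])) = Some (map (\<lambda>v. v e) ws)"
    using step.IH[of "vs @ [v]"] step.prems by auto
  then show ?case
    by (intro exI[of _ "c # cs"] exI[of _ ws]) (simp add: c)
qed

lemma adjoins_program:
  assumes "adjoins (set vs) n (set ys)"
  shows "\<exists>P. cost P \<le> n \<and> (\<forall>e. computes P (map (\<lambda>v. v e) vs) (map (\<lambda>v. v e) ys))"
proof -
  obtain cs ws where cs: "length cs \<le> n" and ws: "set ys \<subseteq> insert (\<lambda>_. 1) (set ws)"
    and ex: "\<And>e. exec cs (map (\<lambda>v. v e) vs) = Some (map (\<lambda>v. v e) ws)"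
    using adjoins_code[OF assms, of vs] by auto
  have "\<forall>y\<in>set ys. \<exists>a. \<forall>e. operand_val (map (\<lambda>v. v e) ws) a = Some (y e)"
    using operand_for[of _ ws] ws by (metis append_Nil2 subsetD)
  then obtain g where g: "\<And>y e. y \<in> set ys \<Longrightarrow> operand_val (map (\<lambda>v. v e) ws) (g y) = Some (y e)"
    by metis
  show ?thesis
    by (rule exI[of _ "Program cs (map g ys)"])
      (use cs in \<open>auto simp: cost_def computes_def ex g\<close>)
qed

section \<open>Decomposing the collision sum\<close>

definition pairs :: "nat \<Rightarrow> nat \<Rightarrow> (nat \<times> nat) set" where
  "pairs N s = {(k, l). k \<in> {1..N} \<and> l \<in> {1..N} \<and> k + l = s}"

definition layer :: "nat \<Rightarrow> (nat \<Rightarrow> nat \<Rightarrow> 'a::comm_ring_1) \<Rightarrow> nat \<Rightarrow> nat \<Rightarrow> 'a" where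
  "layer N u s m = (\<Sum>(k, l) | (k, l) \<in> pairs N s \<and> min k l = m. u k l)"

definition tail :: "nat \<Rightarrow> (nat \<Rightarrow> nat \<Rightarrow> 'a::comm_ring_1) \<Rightarrow> nat \<Rightarrow> nat \<Rightarrow> 'a" where
  "tail N u s q = (\<Sum>m = q..N. layer N u s m)"

text \<open>Indices start at \<open>1\<close>, so the value of \<open>r\<close> just below the range counts as
  \<open>0\<close>, whatever \<open>r 0\<close> is.\<close>

definition incr :: "(nat \<Rightarrow> 'a::comm_ring_1) \<Rightarrow> nat \<Rightarrow> 'a" where
  "incr r m = r m - (if m = 1 then 0 else r (m - 1))"

definition inner :: "nat \<Rightarrow> (nat \<Rightarrow> 'a::comm_ring_1) \<Rightarrow> (nat \<Rightarrow> nat \<Rightarrow> 'a) \<Rightarrow> nat \<Rightarrow> nat \<Rightarrow> 'a" where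
  "inner N r u s p = (\<Sum>q = 1..p. incr r q * tail N u s q)"

lemma finite_pairs: "finite (pairs N s)"
  by (rule finite_subset[of _ "{1..N} \<times> {1..N}"]) (auto simp: pairs_def)

lemma sum_incr: "1 \<le> p \<Longrightarrow> (\<Sum>q = 1..p. incr r q) = r p"
proof (induction p)
  case (Suc p)
  then show ?case by (cases p) (auto simp: incr_def)
qed simp

text \<open>Layer-cake summation: group the pairs by \<open>m = min k l\<close>, expand
  \<open>r (min p m)\<close> into the increments with \<open>q \<le> p\<close> and \<open>q \<le> m\<close>, and exchange
  the sums over \<open>m\<close> and \<open>q\<close>.\<close>

lemma inner_eq:
  assumes p: "1 \<le> p" "p \<le> N"
  shows "inner N r u s p = (\<Sum>(k, l)\<in>pairs N s. r (min p (min k l)) * u k l)"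
proof -
  have "(\<Sum>(k, l)\<in>pairs N s. r (min p (min k l)) * u k l)
      = (\<Sum>m = 1..N. \<Sum>(k, l) | (k, l) \<in> pairs N s \<and> min k l = m. r (min p (min k l)) * u k l)"
    using sum.group[of "pairs N s" "{1..N}" "\<lambda>(k, l). min k l" "\<lambda>(k, l). r (min p (min k l)) * u k l"]
      finite_pairs
    by (fastforce simp: pairs_def case_prod_unfold min_def intro: sum.cong)
  also have "\<dots> = (\<Sum>m = 1..N. r (min p m) * layer N u s m)"
    by (auto simp: layer_def sum_distrib_left intro!: sum.cong)
  also have "\<dots> = (\<Sum>m = 1..N. \<Sum>q = 1..p. if q \<le> m then incr r q * layer N u s m else 0)"
  proof (rule sum.cong[OF refl])
    fix m assume m: "m \<in> {1..N}"
    have "r (min p m) = (\<Sum>q = 1..min p m. incr r q)"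
      using m p by (subst sum_incr) auto
    also have "{1..min p m} = {q \<in> {1..p}. q \<le> m}" by auto
    also have "(\<Sum>q\<in>{q \<in> {1..p}. q \<le> m}. incr r q) = (\<Sum>q = 1..p. if q \<le> m then incr r q else 0)"
      by (rule sum.inter_filter) simp
    finally show "r (min p m) * layer N u s m
        = (\<Sum>q = 1..p. if q \<le> m then incr r q * layer N u s m else 0)"
      by (simp add: sum_distrib_right if_distrib[of "\<lambda>x. x * _"] cong: if_cong)
  qed
  also have "\<dots> = (\<Sum>q = 1..p. \<Sum>m = 1..N. if q \<le> m then incr r q * layer N u s m else 0)"
    by (rule sum.swap)
  also have "\<dots> = inner N r u s p"
    unfolding inner_def tail_def sum_distrib_left
  proof (rule sum.cong[OF refl])
    fix q assume q: "q \<in> {1..p}"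
    have "{q..N} = {m \<in> {1..N}. q \<le> m}" using q by auto
    then show "(\<Sum>m = 1..N. if q \<le> m then incr r q * layer N u s m else 0)
        = (\<Sum>m = q..N. incr r q * layer N u s m)"
      by (simp only: sum.inter_filter[OF finite_atLeastAtMost])
  qed
  finally show ?thesis ..
qed

definition collision :: "nat \<Rightarrow> (nat \<Rightarrow> 'a::comm_ring_1) \<Rightarrow> (nat \<Rightarrow> 'a) \<Rightarrow> nat \<Rightarrow> 'a" where
  "collision N r f i = (\<Sum>j = 1..N.
     (1 + f i + f j) * inner N r (\<lambda>k l. f k * f l) (i + j) (min i j) -
     (f i * f j) * inner N r (\<lambda>k l. 1 + f k + f l) (i + j) (min i j))"

text \<open>The substitution \<open>(j, l) \<mapsto> (j, i + j - l, l)\<close> turns the sum into one over \<open>j\<close> and the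
  pairs on the line \<open>k + l = i + j\<close>. The products of all four values of \<open>f\<close>
  cancel, so the bracket separates into two terms of the form (factor in \<open>i, j\<close>) times
  (factor in \<open>k, l\<close>).\<close>

lemma collision_eq:
  assumes i: "i \<in> {1..N}"
  shows "(\<Sum>(j, l) | j \<in> {1..N} \<and> l \<in> {1..N} \<and> 1 \<le> i + j - l \<and> i + j - l \<le> N.
           let k = i + j - l in r (min (min i j) (min k l)) *
             (f k * f l * (1 + f i) * (1 + f j) - f i * f j * (1 + f k) * (1 + f l)))
         = collision N r f i" (is "sum ?g ?S = _")
proof -
  define h where "h = (\<lambda>j (k, l). r (min (min i j) (min k l)) *
             (f k * f l * (1 + f i) * (1 + f j) - f i * f j * (1 + f k) * (1 + f l)))"
  have "sum ?g ?S = (\<Sum>(j, kl) \<in> (SIGMA j:{1..N}. pairs N (i + j)). h j kl)"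
    by (rule sum.reindex_bij_witness[of _ "\<lambda>(j, k, l). (j, l)" "\<lambda>(j, l). (j, i + j - l, l)"])
      (auto simp: pairs_def h_def Let_def)
  also have "\<dots> = (\<Sum>j = 1..N. \<Sum>kl\<in>pairs N (i + j). h j kl)"
    by (rule sum.Sigma[symmetric]) (auto simp: finite_pairs)
  also have "\<dots> = collision N r f i"
    unfolding collision_def
  proof (rule sum.cong[OF refl])
    fix j assume j: "j \<in> {1..N}"
    have m: "1 \<le> min i j" "min i j \<le> N" using i j by auto
    have "(\<Sum>kl\<in>pairs N (i + j). h j kl) = (\<Sum>(k, l)\<in>pairs N (i + j).
        (1 + f i + f j) * (r (min (min i j) (min k l)) * (f k * f l)) -
        (f i * f j) * (r (min (min i j) (min k l)) * (1 + f k + f l)))"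
      by (rule sum.cong[OF refl]) (auto simp: h_def algebra_simps)
    then show "(\<Sum>kl\<in>pairs N (i + j). h j kl) =
        (1 + f i + f j) * inner N r (\<lambda>k l. f k * f l) (i + j) (min i j) -
        (f i * f j) * inner N r (\<lambda>k l. 1 + f k + f l) (i + j) (min i j)"
      by (simp add: inner_eq[OF m] sum_distrib_left sum_subtractf case_prod_unfold)
  qed
  finally show ?thesis .
qed

text \<open>Strict monotonicity of the grid turns the minimum of grid points into a minimum of
  indices, which a program can have fixed in advance.\<close>

lemma Q_tilde_eq:
  assumes eps: "strict_mono_on {1..N} eps" and i: "i \<in> {1..N}"
  shows "Q_tilde R N eps \<rho> f i = (R / real N)\<^sup>2 * collision N (\<lambda>m. \<rho> (eps m)) f i"
proof -
  have mn: "min (eps a) (eps b) = eps (min a b)" if "a \<in> {1..N}" "b \<in> {1..N}" for a b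
    using strict_mono_on_leD[OF eps, of a b] strict_mono_on_leD[OF eps, of b a] that
    by (auto simp: min_def)
  have "Min {eps i, eps j, eps k, eps l} = eps (min (min i j) (min k l))"
    if "j \<in> {1..N}" "k \<in> {1..N}" "l \<in> {1..N}" for j k l
  proof -
    have "min (min (eps i) (eps j)) (min (eps k) (eps l)) = min (eps (min i j)) (eps (min k l))"
      using that i by (simp only: mn)
    also have "\<dots> = eps (min (min i j) (min k l))"
      using that i by (intro mn) auto
    finally show ?thesis by (simp add: min.assoc)
  qed
  then show ?thesis
    unfolding Q_tilde_def collision_eq[OF i, symmetric]
    by (intro arg_cong2[of _ _ _ _ "(*)"] refl sum.cong) (auto simp: Let_def)
qed

lemma of_real_collision:
  "of_real (collision N r f i)
    = (collision N (\<lambda>m. of_real (r m)) (\<lambda>m. of_real (f m)) i :: 'a::{real_algebra_1, comm_ring_1})"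
proof -
  have "of_real (incr r m) = (incr (\<lambda>m. of_real (r m)) m :: 'a)" for m
    by (simp add: incr_def)
  moreover have "of_real (tail N u s q) = (tail N (\<lambda>k l. of_real (u k l)) s q :: 'a)" for u s q
    by (simp add: tail_def layer_def case_prod_unfold)
  ultimately show ?thesis
    by (simp add: collision_def inner_def)
qed

section \<open>The cost of the collision sum\<close>

text \<open>Only \<open>(m, s - m)\<close> and \<open>(s - m, m)\<close> can lie on the line \<open>k + l = s\<close>
  with minimum \<open>m\<close>.\<close>

lemma adjoins_layer:
  assumes u: "\<And>k l. k \<in> {1..N} \<Longrightarrow> l \<in> {1..N} \<Longrightarrow> (\<lambda>e. u e k l) \<in> A"
    and zero: "(\<lambda>_. 0) \<in> A"
  shows "adjoins A 2 {\<lambda>e. layer N (u e) s m}"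
proof -
  let ?P = "{(k, l). (k, l) \<in> pairs N s \<and> min k l = m}"
  have sub: "?P \<subseteq> {(m, s - m), (s - m, m)}"
    by (auto simp: pairs_def min_def split: if_splits)
  then have card: "card ?P \<le> 2"
    using card_mono[OF _ sub] card_insert_le_m1[of 2 "{(s - m, m)}" "(m, s - m)"] by simp
  have "adjoins A (card ?P) {\<lambda>e. \<Sum>kl\<in>?P. (\<lambda>e. u e (fst kl) (snd kl)) e}"
    using sub by (intro adjoins_sum zero) (auto simp: pairs_def intro: u finite_subset)
  then show ?thesis
    by (rule adjoins_mono) (use card in \<open>auto simp: layer_def case_prod_unfold\<close>)
qed

lemma adjoins_tail:
  assumes lay: "\<And>m. m \<in> {1..N} \<Longrightarrow> (\<lambda>e. layer N (u e) s m) \<in> A" and zero: "(\<lambda>_. 0) \<in> A"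
  shows "adjoins A N ((\<lambda>q e. tail N (u e) s q) ` {1..N})"
proof -
  \<comment> \<open>Suffix sums as running sums that go down from the empty sum at \<open>Suc N\<close>.\<close>
  define S where "S = (\<lambda>p e. tail N (u e) s (Suc N - p))"
  have "S (Suc p) = (\<lambda>e. S p e + layer N (u e) s (N - p))" if "p < N" for p
    using that by (auto simp: S_def tail_def sum.atLeast_Suc_atMost[of "N - p"] Suc_diff_le)
  moreover have "(\<lambda>e. layer N (u e) s (N - p)) \<in> A" if "p < N" for p
    using that by (intro lay) auto
  ultimately have "adjoins A N (S ` {..N})"
    by (intro adjoins_running) (auto simp: S_def tail_def zero)
  then show ?thesis
  proof (rule adjoins_mono)
    show "(\<lambda>q e. tail N (u e) s q) ` {1..N} \<subseteq> S ` {..N}"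
    proof
      fix x assume "x \<in> (\<lambda>q e. tail N (u e) s q) ` {1..N}"
      then obtain q where q: "q \<in> {1..N}" and x: "x = (\<lambda>e. tail N (u e) s q)" by blast
      then have "x = S (Suc N - q)" by (simp add: S_def)
      with q show "x \<in> S ` {..N}" by auto
    qed
  qed simp_all
qed

text \<open>Per value of \<open>p\<close>: two operations for the layer and one each for the suffix sum, the
  product with the increment and the prefix sum.\<close>

lemma adjoins_inner_row:
  assumes d: "\<And>q. q \<in> {1..N} \<Longrightarrow> (\<lambda>e. incr (r e) q) \<in> A"
    and u: "\<And>k l. k \<in> {1..N} \<Longrightarrow> l \<in> {1..N} \<Longrightarrow> (\<lambda>e. u e k l) \<in> A"
    and zero: "(\<lambda>_. 0) \<in> A"
  shows "adjoins A (5 * N) ((\<lambda>p e. inner N (r e) (u e) s p) ` {1..N})"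
proof -
  define L where "L = (\<lambda>m e. layer N (u e) s m) ` {1..N}"
  define T where "T = (\<lambda>q e. tail N (u e) s q) ` {1..N}"
  define D where "D = (\<lambda>q e. incr (r e) q * tail N (u e) s q) ` {1..N}"
  have 1: "adjoins A (card {1..N} * 2) L"
    unfolding L_def by (intro adjoins_image adjoins_layer u zero finite_atLeastAtMost)
  have 2: "adjoins (A \<union> L) N T"
    unfolding T_def by (intro adjoins_tail) (auto simp: L_def zero)
  have 3: "adjoins (A \<union> L \<union> T) (card {1..N} * 1) D"
    unfolding D_def
    by (intro adjoins_image adjoins_one_op one_op_mult) (auto simp: T_def intro: d)
  have "adjoins (A \<union> L \<union> T \<union> D) N ((\<lambda>p e. inner N (r e) (u e) s p) ` {..N})"
  proof (intro adjoins_running)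
    show "(\<lambda>e. inner N (r e) (u e) s 0) \<in> A \<union> L \<union> T \<union> D"
      by (simp add: inner_def zero)
    fix p assume "p < N"
    then show "\<exists>a\<in>A \<union> L \<union> T \<union> D. (\<lambda>e. inner N (r e) (u e) s (Suc p)) = (\<lambda>e. inner N (r e) (u e) s p + a e)"
      by (intro bexI[of _ "\<lambda>e. incr (r e) (Suc p) * tail N (u e) s (Suc p)"])
        (auto simp: inner_def D_def)
  qed
  from adjoins_trans[OF 1 adjoins_trans[OF 2 adjoins_trans[OF 3 this]]]
  show ?thesis by (rule adjoins_mono) auto
qed

lemma adjoins_collision_term:
  assumes "f1 \<in> A" "f2 \<in> A" "f3 \<in> A" "f4 \<in> A"
  shows "adjoins A 3 {\<lambda>e. f1 e * f2 e - f3 e * f4 e}"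
proof -
  have 1: "adjoins A 1 {\<lambda>e. f1 e * f2 e}" and 2: "adjoins A 1 {\<lambda>e. f3 e * f4 e}"
    by (intro adjoins_one_op one_op_mult assms)+
  have "adjoins (A \<union> ({\<lambda>e. f1 e * f2 e} \<union> {\<lambda>e. f3 e * f4 e})) 1
      {\<lambda>e. f1 e * f2 e - f3 e * f4 e}"
    by (rule adjoins_one_op[OF one_op_diff]) auto
  from adjoins_trans[OF adjoins_Un[OF 1 2] this] show ?thesis by (simp add: numeral_3_eq_3)
qed

text \<open>The \<open>2 * N\<close> rows for each of the two weights give \<open>20 * N\<^sup>2\<close> operations;
  the tables of the weights and the outer sums over \<open>j\<close> add \<open>6 * N\<^sup>2\<close>, and everything else
  is linear in \<open>N\<close>. The number \<open>N\<close> itself is obtained by adding up ones.\<close>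

lemma adjoins_collision:
  assumes N: "N \<ge> 1" and R: "R \<in> A"
    and r: "\<And>i. i \<in> {1..N} \<Longrightarrow> (\<lambda>e. r e i) \<in> A"
    and f: "\<And>i. i \<in> {1..N} \<Longrightarrow> (\<lambda>e. f e i) \<in> A"
  shows "adjoins A (33 * N\<^sup>2)
    ((\<lambda>i e. (R e / of_nat N)\<^sup>2 * collision N (r e) (f e) i) ` {1..N})"
proof -
  define u where "u = (\<lambda>e k l. f e k * f e l)"
  define v where "v = (\<lambda>e k l. 1 + f e k + f e l)"
  define sq where "sq = {1..N} \<times> {1..N}"
  have sq: "finite sq" "card sq = N\<^sup>2" by (simp_all add: sq_def power2_eq_square)
  define A0 where "A0 = insert (\<lambda>_. 1) (insert (\<lambda>_. 0) A)"
  define W1 where "W1 = {\<lambda>_::'a. of_nat N :: complex}"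
  define W2 where "W2 = {\<lambda>e. R e / of_nat N}"
  define W3 where "W3 = {\<lambda>e. (R e / of_nat N)\<^sup>2}"
  define D where "D = (\<lambda>q e. incr (r e) q) ` {1..N}"
  define U where "U = (\<lambda>(k, l) e. u e k l) ` sq"
  define V0 where "V0 = (\<lambda>k e. 1 + f e k) ` {1..N}"
  define V where "V = (\<lambda>(k, l) e. v e k l) ` sq"
  define HU where "HU = (\<Union>s\<in>{1..2*N}. (\<lambda>p e. inner N (r e) (u e) s p) ` {1..N})"
  define HV where "HV = (\<Union>s\<in>{1..2*N}. (\<lambda>p e. inner N (r e) (v e) s p) ` {1..N})"
  define summand where "summand = (\<lambda>i j e. v e i j * inner N (r e) (u e) (i + j) (min i j)
      - u e i j * inner N (r e) (v e) (i + j) (min i j))"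
  define X where "X = (\<lambda>(i, j). summand i j) ` sq"
  define Y where "Y = (\<lambda>i e. collision N (r e) (f e) i) ` {1..N}"
  define Z where "Z = (\<lambda>i e. (R e / of_nat N)\<^sup>2 * collision N (r e) (f e) i) ` {1..N}"
  define A1 where "A1 = A0 \<union> W1"
  define A2 where "A2 = A1 \<union> W2"
  define A3 where "A3 = A2 \<union> W3"
  define A4 where "A4 = A3 \<union> D"
  define A5 where "A5 = A4 \<union> U"
  define A6 where "A6 = A5 \<union> V0"
  define A7 where "A7 = A6 \<union> V"
  define A8 where "A8 = A7 \<union> HU"
  define A9 where "A9 = A8 \<union> HV"
  define A10 where "A10 = A9 \<union> X"
  define A11 where "A11 = A10 \<union> Y"
  note As = A0_def A1_def A2_def A3_def A4_def A5_def A6_def A7_def A8_def A9_def A10_def A11_def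
  have inD: "(\<lambda>e. incr (r e) q) \<in> D" if "q \<in> {1..N}" for q
    unfolding D_def using that by (rule imageI)
  have inU: "(\<lambda>e. u e k l) \<in> U" and inV: "(\<lambda>e. v e k l) \<in> V"
    and inX: "summand k l \<in> X" if "k \<in> {1..N}" "l \<in> {1..N}" for k l
    unfolding U_def V_def X_def by (rule image_eqI[of _ _ "(k, l)"], use that in \<open>auto simp: sq_def\<close>)+
  have inV0: "(\<lambda>e. 1 + f e k) \<in> V0" if "k \<in> {1..N}" for k
    unfolding V0_def using that by (rule imageI)
  have inY: "(\<lambda>e. collision N (r e) (f e) i) \<in> Y" if "i \<in> {1..N}" for i
    unfolding Y_def using that by (rule imageI)
  have inHU: "(\<lambda>e. inner N (r e) (u e) (i + j) (min i j)) \<in> HU"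
    and inHV: "(\<lambda>e. inner N (r e) (v e) (i + j) (min i j)) \<in> HV"
    if "i \<in> {1..N}" "j \<in> {1..N}" for i j
  proof -
    have ij: "i + j \<in> {1..2*N}" "min i j \<in> {1..N}" using that by auto
    show "(\<lambda>e. inner N (r e) (u e) (i + j) (min i j)) \<in> HU"
      unfolding HU_def by (rule UN_I[OF ij(1)], rule imageI, rule ij(2))
    show "(\<lambda>e. inner N (r e) (v e) (i + j) (min i j)) \<in> HV"
      unfolding HV_def by (rule UN_I[OF ij(1)], rule imageI, rule ij(2))
  qed
  have "adjoins A0 (card {1..N}) {\<lambda>e. \<Sum>i = 1..N. (\<lambda>_. 1) e}"
    by (intro adjoins_sum) (auto simp: A0_def)
  then have s1: "adjoins A0 N W1" by (simp add: W1_def)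
  have s2: "adjoins A1 1 W2"
    unfolding W2_def by (intro adjoins_one_op one_op_divide) (use R N in \<open>auto simp: As W1_def\<close>)
  have s3: "adjoins A2 1 W3"
    unfolding W3_def power2_eq_square
    by (intro adjoins_one_op one_op_mult) (auto simp: A2_def W2_def)
  have "(\<lambda>e. if m = 1 then 0 else r e (m - 1)) \<in> A3" if "m \<in> {1..N}" for m
  proof (cases "m = 1")
    case False
    with that have "m - 1 \<in> {1..N}" by auto
    from r[OF this] False show ?thesis by (simp add: As)
  qed (simp add: As)
  then have s4: "adjoins A3 (card {1..N} * 1) D"
    unfolding D_def incr_def
    by (intro adjoins_image adjoins_one_op one_op_diff) (use r in \<open>auto simp: As\<close>)
  have s5: "adjoins A4 (card sq * 1) U"
    unfolding U_def u_def case_prod_unfold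
    by (intro adjoins_image adjoins_one_op one_op_mult sq) (use f in \<open>auto simp: As sq_def\<close>)
  have s6: "adjoins A5 (card {1..N} * 1) V0"
    unfolding V0_def
    by (intro adjoins_image adjoins_one_op one_op_add) (use f in \<open>auto simp: As\<close>)
  have s7: "adjoins A6 (card sq * 1) V"
    unfolding V_def v_def case_prod_unfold
    by (intro adjoins_image adjoins_one_op one_op_add sq) (use f inV0 in \<open>auto simp: As sq_def\<close>)
  have s8: "adjoins A7 (card {1..2*N} * (5 * N)) HU"
    unfolding HU_def
    by (intro adjoins_UN adjoins_inner_row) (use inD inU in \<open>auto simp: As\<close>)
  have s9: "adjoins A8 (card {1..2*N} * (5 * N)) HV"
    unfolding HV_def
    by (intro adjoins_UN adjoins_inner_row) (use inD inV in \<open>auto simp: As\<close>)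
  have "adjoins A9 3 {summand i j}" if "i \<in> {1..N}" "j \<in> {1..N}" for i j
    unfolding summand_def
    by (rule adjoins_collision_term) (use that inU inV inHU inHV in \<open>auto simp: As\<close>)
  then have s10: "adjoins A9 (card sq * 3) X"
    unfolding X_def by (intro adjoins_image sq) (auto simp: sq_def)
  have "adjoins A10 (card {1..N} * card {1..N}) Y"
    unfolding Y_def
  proof (intro adjoins_image)
    fix i assume i: "i \<in> {1..N}"
    have "adjoins A10 (card {1..N}) {\<lambda>e. \<Sum>j = 1..N. summand i j e}"
      by (intro adjoins_sum) (use i inX in \<open>auto simp: As\<close>)
    then show "adjoins A10 (card {1..N}) {\<lambda>e. collision N (r e) (f e) i}"
      by (simp only: collision_def summand_def u_def v_def)
  qed simp
  then have s11: "adjoins A10 (N\<^sup>2) Y" by (simp add: power2_eq_square)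
  have s12: "adjoins A11 (card {1..N} * 1) Z"
    unfolding Z_def
    by (intro adjoins_image adjoins_one_op one_op_mult) (use inY in \<open>auto simp: As W3_def\<close>)
  define n where "n = N + (1 + (1 + (card {1..N} * 1 + (card sq * 1 + (card {1..N} * 1 + (card sq * 1 +
    (card {1..2*N} * (5 * N) + (card {1..2*N} * (5 * N) + (card sq * 3 + (N\<^sup>2 + card {1..N} * 1))))))))))"
  have "adjoins A0 n Z"
    unfolding n_def
    by (rule adjoins_trans[OF s1], fold A1_def, rule adjoins_trans[OF s2], fold A2_def,
        rule adjoins_trans[OF s3], fold A3_def, rule adjoins_trans[OF s4], fold A4_def,
        rule adjoins_trans[OF s5], fold A5_def, rule adjoins_trans[OF s6], fold A6_def,
        rule adjoins_trans[OF s7], fold A7_def, rule adjoins_trans[OF s8], fold A8_def,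
        rule adjoins_trans[OF s9], fold A9_def, rule adjoins_trans[OF s10], fold A10_def,
        rule adjoins_trans[OF s11], fold A11_def, rule s12)
  then have "adjoins (insert (\<lambda>_. 0) (insert (\<lambda>_. 1) A)) n Z"
    by (simp add: A0_def insert_commute)
  moreover have "one_op (insert (\<lambda>_. 1) A) (\<lambda>_. 0)"
    using one_op_diff[of "\<lambda>_. 1" "insert (\<lambda>_. 1) A" "\<lambda>_. 1"] by simp
  ultimately have "adjoins A (Suc n) Z"
    by (blast intro: adjoins.one[OF adjoins.step])
  then show ?thesis
    unfolding Z_def
  proof (rule adjoins_mono)
    have "Suc n = 26 * N\<^sup>2 + 4 * N + 3"
      using sq(2) by (simp add: n_def power2_eq_square)
    moreover have "N \<le> N\<^sup>2" "1 \<le> N\<^sup>2" using N by (simp_all add: power2_eq_square)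
    ultimately show "Suc n \<le> 33 * N\<^sup>2" by linarith
  qed simp_all
qed

theorem mainTheorem3:
  shows "\<exists>(C::real) (P :: nat \<Rightarrow> program). C > 0 \<and>
    (\<forall>N::nat. N \<ge> 2 \<longrightarrow>
       real (cost (P N)) \<le> C * (real N ^ 2 * log 2 (real N)) \<and>
       (\<forall>(R::real) (eps :: nat \<Rightarrow> real) (\<rho> :: real \<Rightarrow> real) (f :: nat \<Rightarrow> real).
          R > 0 \<longrightarrow> equally_spaced R N eps \<longrightarrow>
          (\<forall>i\<in>{1..N}. \<rho> (eps i) \<ge> 0) \<longrightarrow> (\<forall>i\<in>{1..N}. f i \<ge> 0) \<longrightarrow>
          computes (P N)
            (map complex_of_real
              (R # map (\<lambda>i. \<rho> (eps i)) [1..<N+1] @ map f [1..<N+1]))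
            (map (\<lambda>i. complex_of_real (Q_tilde R N eps \<rho> f i)) [1..<N+1])))"
proof -
  \<comment> \<open>The program sees the grid and the density only through the values at the grid points.\<close>
  define Rv :: "complex \<times> (nat \<Rightarrow> complex) \<times> (nat \<Rightarrow> complex) \<Rightarrow> complex" where "Rv = fst"
  define rv :: "complex \<times> (nat \<Rightarrow> complex) \<times> (nat \<Rightarrow> complex) \<Rightarrow> nat \<Rightarrow> complex" where "rv = fst \<circ> snd"
  define fv :: "complex \<times> (nat \<Rightarrow> complex) \<times> (nat \<Rightarrow> complex) \<Rightarrow> nat \<Rightarrow> complex" where "fv = snd \<circ> snd"
  define xs where "xs N = Rv # map (\<lambda>i e. rv e i) [1..<N+1] @ map (\<lambda>i e. fv e i) [1..<N+1]" for N
  have upt: "set [1..<N+1] = {1..N}" for N by auto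
  define ys where "ys N = map (\<lambda>i e. (Rv e / of_nat N)\<^sup>2 * collision N (rv e) (fv e) i) [1..<N+1]" for N
  have "\<exists>P. cost P \<le> 33 * N\<^sup>2 \<and> (\<forall>e. computes P (map (\<lambda>v. v e) (xs N)) (map (\<lambda>v. v e) (ys N)))"
    if N: "N \<ge> 2" for N
  proof (rule adjoins_program)
    have "adjoins (set (xs N)) (33 * N\<^sup>2)
        ((\<lambda>i e. (Rv e / of_nat N)\<^sup>2 * collision N (rv e) (fv e) i) ` {1..N})"
      by (rule adjoins_collision)
        (use N in \<open>auto simp: xs_def image_iff simp del: upt_Suc\<close>)
    then show "adjoins (set (xs N)) (33 * N\<^sup>2) (set (ys N))"
      by (simp only: ys_def set_map upt)
  qed
  then obtain P where P_cost: "\<And>N. N \<ge> 2 \<Longrightarrow> cost (P N) \<le> 33 * N\<^sup>2"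
    and P: "\<And>N e. N \<ge> 2 \<Longrightarrow> computes (P N) (map (\<lambda>v. v e) (xs N)) (map (\<lambda>v. v e) (ys N))"
    by metis
  show ?thesis
  proof (intro exI[of _ "33::real"] exI[of _ P] conjI allI impI)
    fix N :: nat assume N: "N \<ge> 2"
    have "real (cost (P N)) \<le> real (33 * N\<^sup>2)"
      using P_cost[OF N] by (simp only: of_nat_le_iff)
    also have "\<dots> = 33 * (real N ^ 2 * 1)" by simp
    also have "\<dots> \<le> 33 * (real N ^ 2 * log 2 (real N))"
      using N by (intro mult_left_mono) auto
    finally show "real (cost (P N)) \<le> 33 * (real N ^ 2 * log 2 (real N))" .
  next
    fix N :: nat and R :: real and eps :: "nat \<Rightarrow> real" and \<rho> :: "real \<Rightarrow> real" and f :: "nat \<Rightarrow> real"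
    assume N: "N \<ge> 2" and "equally_spaced R N eps"
    then have eps: "strict_mono_on {1..N} eps" by (simp add: equally_spaced_def)
    define e where "e = (complex_of_real R, \<lambda>m. complex_of_real (\<rho> (eps m)), \<lambda>m. complex_of_real (f m))"
    have "map (\<lambda>v. v e) (xs N) = map complex_of_real
        (R # map (\<lambda>i. \<rho> (eps i)) [1..<N+1] @ map f [1..<N+1])"
      by (simp add: xs_def e_def Rv_def rv_def fv_def)
    moreover have "complex_of_real (Q_tilde R N eps \<rho> f i)
        = (Rv e / of_nat N)\<^sup>2 * collision N (rv e) (fv e) i" if "i \<in> {1..N}" for i
      by (simp add: Q_tilde_eq[OF eps that] of_real_collision e_def Rv_def rv_def fv_def)
    then have "map (\<lambda>v. v e) (ys N)
        = map (\<lambda>i. complex_of_real (Q_tilde R N eps \<rho> f i)) [1..<N+1]"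
      by (auto simp: ys_def)
    ultimately show "computes (P N)
            (map complex_of_real
              (R # map (\<lambda>i. \<rho> (eps i)) [1..<N+1] @ map f [1..<N+1]))
            (map (\<lambda>i. complex_of_real (Q_tilde R N eps \<rho> f i)) [1..<N+1])"
      using P[OF N, of e] by metis
  qed simp
qed

end
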